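(* Let $t$ and $s$ be indeterminates. For every rooted tree $T$ we have $$\psi_T(t+s)=\psi_T(t)+\psi_T(s)+\sum_{T'<T}\psi_{T\backslash T'}(t)\,\psi_{T'}(s),$$ where the sum runs over all proper rooted subtrees $T'$ of $T$.
   Context: A rooted tree is a finite connected acyclic graph with a designated root $\mathrm{rt}_T$. $E(T)$ is the edge set and $v(T)$ the number of vertices. A rooted subtree $T'$ of $T$ is a connected subgraph containing $\mathrm{rt}_T$, rooted at $\mathrm{rt}_T$; it is proper ($T'<T$) if $T'\neq T$, and then $T\backslash T'$ is the graph obtained by deleting all vertices of $T'$ and all edges adjacent to them. It is a forest (disjoint union of finitely many rooted trees), each component being rooted at its vertex closest to $\mathrm{rt}_T$. For $e\in E(T)$ let $T_e$ be the component of $T$ minus the edge $e$ containing $\mathrm{rt}_T$ (rooted at $\mathrm{rt}_T$), and $T'_e$ the other component, rooted at the endpoint of $e$ farther from $\mathrm{rt}_T$. Write $e\succ f$ if $f\in E(T_e)$; $e_1\succ\cdots\succ e_r$ means $e_i\succ e_j$ for all $i<j$. Such a sequence $\vec e$ determines rooted trees $T_{\vec e,1},\ldots,T_{\vec e,r+1}$: put $S_1=T$ and, for $i=1,\ldots,r$, $T_{\vec e,i}=(S_i)'_{e_i}$, $S_{i+1}=(S_i)_{e_i}$; finally $T_{\vec e,r+1}=S_{r+1}$. The numbers $\phi_T\in\mathbb{Q}$ are defined recursively by $\phi_T=1$ if $v(T)=1$ and, for $v(T)\ge2$, $\phi_T=-\sum_{k=2}^{v(T)}\frac{1}{k!}\sum_{\vec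 e\in E(T)^{k-1},\,e_1\succ\cdots\succ e_{k-1}}\phi_{T_{\vec e,1}}\cdots\phi_{T_{\vec e,k}}$. The polynomials $\psi_T(t)\in\mathbb{Q}[t]$ are $$\psi_T(t)=\sum_{k=1}^{v(T)}\frac{t^k}{k!}\sum_{\substack{\vec e\in E(T)^{k-1}\\ e_1\succ\cdots\succ e_{k-1}}}\phi_{T_{\vec e,1}}\cdots\phi_{T_{\vec e,k}},$$ where the inner sum for $k=1$ is $\phi_T$. For a forest $P$ with component trees $T_1,\ldots,T_k$, $\psi_P(t)=\prod_{i=1}^k\psi_{T_i}(t)$. *)

theory Defs
  imports Complex_Main "HOL-Computational_Algebra.Polynomial"
begin

text \<open>A (simple, undirected) graph consists of a vertex set and a set of edges, an edge being
  a two-element set of vertices; a rooted graph carries a designated vertex in addition.\<close>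

record 'a rgraph =
  verts :: "'a set"
  edges :: "'a set set"
  root :: 'a

definition adj :: "'a set set \<Rightarrow> ('a \<times> 'a) set" where
  "adj E = {(u, v). {u, v} \<in> E}"

definition is_graph :: "'a set \<Rightarrow> 'a set set \<Rightarrow> bool" where
  "is_graph V E \<longleftrightarrow> (\<forall>e\<in>E. e \<subseteq> V \<and> card e = 2)"

definition connected_graph :: "'a set \<Rightarrow> 'a set set \<Rightarrow> bool" where
  "connected_graph V E \<longleftrightarrow> (\<forall>u\<in>V. \<forall>v\<in>V. (u, v) \<in> (adj E)\<^sup>*)"

definition is_cycle :: "'a set set \<Rightarrow> 'a list \<Rightarrow> bool" where
  "is_cycle E vs \<longleftrightarrow> length vs \<ge> 3 \<and> distinct vs \<and>
     (\<forall>i<length vs. {vs ! i, vs ! (Suc i mod length vs)} \<in> E)"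

definition rooted_tree :: "'a rgraph \<Rightarrow> bool" where
  "rooted_tree T \<longleftrightarrow>
     finite (verts T) \<and> root T \<in> verts T \<and> is_graph (verts T) (edges T) \<and>
     connected_graph (verts T) (edges T) \<and> (\<nexists>vs. is_cycle (edges T) vs)"

definition rooted_subtree :: "'a rgraph \<Rightarrow> 'a rgraph \<Rightarrow> bool" where
  "rooted_subtree T' T \<longleftrightarrow>
     verts T' \<subseteq> verts T \<and> edges T' \<subseteq> edges T \<and> is_graph (verts T') (edges T') \<and>
     connected_graph (verts T') (edges T') \<and> root T \<in> verts T' \<and> root T' = root T"

definition proper_subtrees :: "'a rgraph \<Rightarrow> 'a rgraph set" where
  "proper_subtrees T = {T'. rooted_subtree T' T \<and> T' \<noteq> T}"

text \<open>Graph distance from the root; only meaningful for vertices reachable from the root.\<close>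

definition depth :: "'a rgraph \<Rightarrow> 'a \<Rightarrow> nat" where
  "depth T v = (LEAST n. (root T, v) \<in> adj (edges T) ^^ n)"

text \<open>The vertex set of the connected component containing \<open>v\<close>.\<close>

definition component :: "'a set set \<Rightarrow> 'a \<Rightarrow> 'a set" where
  "component E v = {w. (v, w) \<in> (adj E)\<^sup>*}"

definition induced :: "'a set set \<Rightarrow> 'a set \<Rightarrow> 'a \<Rightarrow> 'a rgraph" where
  "induced E C r = \<lparr>verts = C, edges = {f\<in>E. f \<subseteq> C}, root = r\<rparr>"

text \<open>The components of the forest \<open>T \ T'\<close>, each rooted at its vertex closest to the root
  of \<open>T\<close>. A forest is represented by the set of its component trees; these have pairwise
  disjoint nonempty vertex sets, so isomorphic components are not identified.\<close>

definition forest_diff :: "'a rgraph \<Rightarrow> 'a rgraph \<Rightarrow> 'a rgraph set" where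
  "forest_diff T T' =
     (let V = verts T - verts T'; E = {f\<in>edges T. f \<inter> verts T' = {}}
      in {induced E C (arg_min_on (depth T) C) | C. \<exists>v\<in>V. C = component E v})"

definition far_end :: "'a rgraph \<Rightarrow> 'a set \<Rightarrow> 'a" where
  "far_end T e = arg_max_on (depth T) e"

text \<open>\<open>upper T e\<close> is $T_e$ and \<open>lower T e\<close> is $T'_e$.\<close>

definition upper :: "'a rgraph \<Rightarrow> 'a set \<Rightarrow> 'a rgraph" where
  "upper T e = induced (edges T - {e}) (component (edges T - {e}) (root T)) (root T)"

definition lower :: "'a rgraph \<Rightarrow> 'a set \<Rightarrow> 'a rgraph" where
  "lower T e = induced (edges T - {e}) (component (edges T - {e}) (far_end T e)) (far_end T e)"

definition edge_succ :: "'a rgraph \<Rightarrow> 'a set \<Rightarrow> 'a set \<Rightarrow> bool" where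
  "edge_succ T e f \<longleftrightarrow> f \<in> edges (upper T e)"

text \<open>The sequences $e_1 \succ \cdots \succ e_n$ of edges of \<open>T\<close>; \<open>sorted_wrt\<close> relates all
  pairs of positions $i < j$, not only adjacent ones.\<close>

definition edge_chains :: "'a rgraph \<Rightarrow> nat \<Rightarrow> 'a set list set" where
  "edge_chains T n = {es. set es \<subseteq> edges T \<and> length es = n \<and> sorted_wrt (edge_succ T) es}"

fun cut_trees :: "'a rgraph \<Rightarrow> 'a set list \<Rightarrow> 'a rgraph list" where
  "cut_trees S [] = [S]"
| "cut_trees S (e # es) = lower S e # cut_trees (upper S e) es"

subsection \<open>Cut trees are smaller\<close>

lemma adj_sym: "(u, v) \<in> (adj E)\<^sup>* \<Longrightarrow> (v, u) \<in> (adj E)\<^sup>*"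
proof -
  have "sym (adj E)" by (auto simp: sym_def adj_def insert_commute)
  then show "(u, v) \<in> (adj E)\<^sup>* \<Longrightarrow> (v, u) \<in> (adj E)\<^sup>*"
    by (meson sym_rtrancl symD)
qed

lemma path_distinct:
  assumes "(u, v) \<in> (adj E)\<^sup>*"
  shows "\<exists>vs. vs \<noteq> [] \<and> hd vs = u \<and> last vs = v \<and> distinct vs \<and>
           (\<forall>i. Suc i < length vs \<longrightarrow> {vs ! i, vs ! Suc i} \<in> E)"
  using assms
proof (induction rule: rtrancl_induct)
  case base
  show ?case by (rule exI[of _ "[u]"]) auto
next
  case (step y z)
  then obtain vs where vs: "vs \<noteq> []" "hd vs = u" "last vs = y" "distinct vs"
    and E: "\<And>i. Suc i < length vs \<Longrightarrow> {vs ! i, vs ! Suc i} \<in> E" by blast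
  show ?case
  proof (cases "z \<in> set vs")
    case True
    then obtain j where j: "j < length vs" "vs ! j = z" by (auto simp: in_set_conv_nth)
    let ?ws = "take (Suc j) vs"
    have "hd ?ws = u" "?ws \<noteq> []" "distinct ?ws" using vs by auto
    moreover have "last ?ws = z" using j by (simp add: take_Suc_conv_app_nth)
    moreover have "\<forall>i. Suc i < length ?ws \<longrightarrow> {?ws ! i, ?ws ! Suc i} \<in> E" using E by simp
    ultimately show ?thesis by blast
  next
    case False
    let ?ws = "vs @ [z]"
    have "{?ws ! i, ?ws ! Suc i} \<in> E" if "Suc i < length ?ws" for i
    proof (cases "Suc i < length vs")
      case True
      then show ?thesis using E[of i] by (simp add: nth_append)
    next
      case False
      with that have i: "Suc i = length vs" by simp
      then have "vs ! i = y" using vs by (metis diff_Suc_1 last_conv_nth)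
      then show ?thesis using i step(2) by (simp add: nth_append adj_def)
    qed
    then show ?thesis using vs False by (intro exI[of _ ?ws]) auto
  qed
qed

lemma bridge:
  assumes T: "rooted_tree T" and e: "{u, v} \<in> edges T" and uv: "u \<noteq> v"
  shows "(u, v) \<notin> (adj (edges T - {{u, v}}))\<^sup>*"
proof
  let ?E = "edges T - {{u, v}}"
  assume "(u, v) \<in> (adj ?E)\<^sup>*"
  then obtain vs where vs: "vs \<noteq> []" "hd vs = u" "last vs = v" "distinct vs"
    and E: "\<And>i. Suc i < length vs \<Longrightarrow> {vs ! i, vs ! Suc i} \<in> ?E"
    using path_distinct by metis
  have h: "vs ! 0 = u" using vs by (simp add: hd_conv_nth)
  have l: "vs ! (length vs - 1) = v" using vs by (simp add: last_conv_nth)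
  have n1: "length vs \<noteq> 1" using h l uv by auto
  have n2: "length vs \<noteq> 2" using h l E[of 0] by auto
  have "length vs \<noteq> 0" using vs(1) by simp
  with n1 n2 have n: "length vs \<ge> 3" by linarith
  have "{vs ! i, vs ! (Suc i mod length vs)} \<in> edges T" if i: "i < length vs" for i
  proof (cases "Suc i < length vs")
    case True
    then show ?thesis using E[of i] by simp
  next
    case False
    then have "Suc i = length vs" using i by simp
    moreover from this have "i = length vs - 1" by simp
    ultimately show ?thesis using h l e by (simp add: insert_commute)
  qed
  then have "is_cycle (edges T) vs" using n vs by (simp add: is_cycle_def)
  then show False using T by (auto simp: rooted_tree_def)
qed

lemma component_subset:
  assumes "\<Union>E \<subseteq> V"
  shows "component E x \<subseteq> insert x V"
proof
  fix y assume "y \<in> component E x"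
  then have "(x, y) \<in> (adj E)\<^sup>*" by (simp add: component_def)
  then show "y \<in> insert x V"
    by (cases rule: rtranclE) (use assms in \<open>auto simp: adj_def\<close>)
qed

lemma component_card_le:
  assumes "finite V" "V \<noteq> {}" "\<Union>E \<subseteq> V"
  shows "card (component E x) \<le> card V"
proof (cases "x \<in> V")
  case True
  then show ?thesis using component_subset[OF assms(3), of x] assms(1)
    by (intro card_mono) auto
next
  case False
  have "component E x \<subseteq> {x}"
  proof
    fix y assume "y \<in> component E x"
    then have "(x, y) \<in> (adj E)\<^sup>*" by (simp add: component_def)
    then show "y \<in> {x}"
      by (cases rule: converse_rtranclE) (use assms False in \<open>auto simp: adj_def\<close>)
  qed
  then have "card (component E x) \<le> card {x}" by (intro card_mono) auto
  moreover have "card V \<ge> 1" using assms by (simp add: Suc_leI card_gt_0_iff)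
  ultimately show ?thesis by simp
qed

lemma cut_trees_card_le:
  assumes "finite (verts S)" "root S \<in> verts S" "\<Union>(edges S) \<subseteq> verts S"
    and "S' \<in> set (cut_trees S es)"
  shows "card (verts S') \<le> card (verts S)"
  using assms
proof (induction es arbitrary: S)
  case Nil
  then show ?case by simp
next
  case (Cons e es)
  let ?E = "edges S - {e}"
  have sub: "\<Union>?E \<subseteq> verts S" and ne: "verts S \<noteq> {}" using Cons.prems by auto
  note le = component_card_le[OF Cons.prems(1) ne sub]
  from Cons.prems(4) consider "S' = lower S e" | "S' \<in> set (cut_trees (upper S e) es)" by auto
  then show ?case
  proof cases
    case 1
    then show ?thesis using le by (simp add: lower_def induced_def)
  next
    case 2
    have "component ?E (root S) \<subseteq> verts S"
      using component_subset[OF sub, of "root S"] Cons.prems(2) by auto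
    then have fin: "finite (verts (upper S e))"
      using Cons.prems(1) by (simp add: upper_def induced_def finite_subset)
    have "card (verts S') \<le> card (verts (upper S e))"
      by (rule Cons.IH[OF fin _ _ 2]) (auto simp: upper_def induced_def component_def)
    also have "\<dots> \<le> card (verts S)" using le by (simp add: upper_def induced_def)
    finally show ?thesis .
  qed
qed

lemma component_card_less:
  assumes T: "rooted_tree T" and e: "e \<in> edges T" and x: "x \<in> verts T"
  shows "card (component (edges T - {e}) x) < card (verts T)"
proof -
  have "card e = 2" "e \<subseteq> verts T" using T e by (auto simp: rooted_tree_def is_graph_def)
  then obtain u v where uv: "e = {u, v}" "u \<noteq> v" "u \<in> verts T" "v \<in> verts T"
    by (auto simp: card_2_iff)
  have "\<Union>(edges T - {e}) \<subseteq> verts T" using T by (auto simp: rooted_tree_def is_graph_def)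
  from component_subset[OF this, of x] x
  have sub: "component (edges T - {e}) x \<subseteq> verts T" by auto
  have "\<not> (u \<in> component (edges T - {e}) x \<and> v \<in> component (edges T - {e}) x)"
    using bridge[OF T, of u v] uv e adj_sym[of x u "edges T - {e}"]
    by (auto simp: component_def dest: rtrancl_trans)
  then have "component (edges T - {e}) x \<subset> verts T" using sub uv by auto
  then show ?thesis using T by (intro psubset_card_mono) (auto simp: rooted_tree_def)
qed

lemma far_end_in:
  assumes "finite e" "e \<noteq> {}"
  shows "far_end T e \<in> e"
proof -
  obtain k where k: "k \<in> e" using assms by auto
  have "\<forall>y. y \<in> e \<longrightarrow> depth T y < Suc (Max (depth T ` e))"
    using assms by (auto simp: less_Suc_eq_le)
  from arg_max_nat_lemma[of "\<lambda>x. x \<in> e", OF k this]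
  show ?thesis by (simp add: far_end_def arg_max_on_def)
qed

lemma cut_trees_card_less:
  assumes T: "rooted_tree T" and es: "es \<in> edge_chains T n" and n: "n > 0"
    and S: "S \<in> set (cut_trees T es)"
  shows "card (verts S) < card (verts T)"
proof -
  obtain e es' where es': "es = e # es'" "e \<in> edges T"
    using es n by (cases es) (auto simp: edge_chains_def)
  have root: "root T \<in> verts T" and e: "card e = 2" "e \<subseteq> verts T"
    and fin: "finite (verts T)" and sub: "\<Union>(edges T) \<subseteq> verts T"
    using T es' by (auto simp: rooted_tree_def is_graph_def)
  have "far_end T e \<in> verts T" using far_end_in[of e T] e
    by (metis card.empty card.infinite subsetD zero_neq_numeral)
  then have lower: "card (verts (lower T e)) < card (verts T)"
    using component_card_less[OF T es'(2)] by (simp add: lower_def induced_def)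
  have upper: "card (verts (upper T e)) < card (verts T)"
    using component_card_less[OF T es'(2) root] by (simp add: upper_def induced_def)
  have "component (edges T - {e}) (root T) \<subseteq> verts T"
    using component_subset[of "edges T - {e}" "verts T" "root T"] sub root by auto
  then have fin': "finite (verts (upper T e))"
    using fin by (simp add: upper_def induced_def finite_subset)
  have "S = lower T e \<or> S \<in> set (cut_trees (upper T e) es')" using S es' by simp
  moreover have "card (verts S) \<le> card (verts (upper T e))"
    if "S \<in> set (cut_trees (upper T e) es')"
    by (rule cut_trees_card_le[OF fin' _ _ that])
      (auto simp: upper_def induced_def component_def)
  ultimately show ?thesis using lower upper by auto
qed

subsection \<open>The numbers $\phi_T$ and the polynomials $\psi_T$\<close>

text \<open>The value on rooted graphs that are not rooted trees is irrelevant.\<close>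

function phi :: "'a rgraph \<Rightarrow> rat" where
  "phi T =
     (if \<not> rooted_tree T then 0
      else if card (verts T) = 1 then 1
      else - (\<Sum>k = 2..card (verts T). 1 / fact k *
                (\<Sum>es \<in> edge_chains T (k - 1). prod_list (map phi (cut_trees T es)))))"
  by pat_completeness auto
termination
  by (relation "measure (\<lambda>T. card (verts T))") (auto intro: cut_trees_card_less)

declare phi.simps [simp del]

definition psi :: "'a rgraph \<Rightarrow> rat poly" where
  "psi T = (\<Sum>k = 1..card (verts T).
     monom (1 / fact k * (\<Sum>es \<in> edge_chains T (k - 1). prod_list (map phi (cut_trees T es)))) k)"

definition psi_forest :: "'a rgraph set \<Rightarrow> rat poly" where
  "psi_forest P = (\<Prod>T\<in>P. psi T)"

text \<open>The two-variable polynomial ring $\mathbb{Q}[t,s]$ is realised as $\mathbb{Q}[t][s]$;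
  \<open>subst p x\<close> substitutes \<open>x\<close> for the variable of the univariate polynomial \<open>p\<close>.\<close>

definition var_t :: "rat poly poly" where
  "var_t = [:[:0, 1:]:]"

definition var_s :: "rat poly poly" where
  "var_s = [:0, 1:]"

definition subst :: "rat poly \<Rightarrow> rat poly poly \<Rightarrow> rat poly poly" where
  "subst p x = poly (map_poly (\<lambda>c. [:[:c:]:]) p) x"

end

theory Submission imports Defs begin

text \<open>
  Let $\phi^{(k)}_T$ be the inner sum over chains of $k-1$ edges in the definition of
  $\psi_T$. Splitting off the first edge of a chain gives
  $\phi^{(k+1)}_T = \sum_{e\in E(T)} \phi_{T'_e}\,\phi^{(k)}_{T_e}$, and hence the differential
  equation
  \[ \psi_T'(t) = \phi_T + \sum_{e\in E(T)} \phi_{T'_e}\,\psi_{T_e}(t), \qquad \psi_T(0)=0, \]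
  which is \<open>pderiv_psi\<close>. It determines $\psi_T$ once the $\psi_{T_e}$ are known, so the addition
  formula follows by induction on the number of vertices if, for fixed \<open>s\<close>, its two sides have the
  same value at \<open>t = 0\<close> and the same derivative in \<open>t\<close>. At \<open>t = 0\<close> every forest
  \<open>T \ T'\<close> with \<open>T' < T\<close> contributes nothing. For the derivatives, the product rule gives
  \[ \psi_{T\backslash T'}'(t) =
       \sum_{e\in E(T)\setminus E(T')} \phi_{T'_e}\,\psi_{T_e\backslash T'}(t), \]
  which is \<open>pderiv_psi_forest\<close>: an edge outside \<open>T'\<close> either joins \<open>T'\<close> to a component of the
  forest, and cutting it removes this component, or it lies inside a component, and cutting it
  shortens this component. Now a pair of an edge \<open>e\<close> and a rooted subtree of $T_e$ is the same as a
  pair of a rooted subtree \<open>T'\<close> and an edge outside it (\<open>subtree_upper_iff\<close>), so exchanging the two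
  sums turns the induction hypothesis for all $T_e$ into the equality of the derivatives.

  The graph theory is reduced to algebra of vertex sets. Cutting an edge \<open>e\<close> splits the vertices
  into those of \<open>upper T e\<close> and the others, and all trees that occur are induced subgraphs of
  \<open>T\<close>; \<open>cut_induced\<close> says how a second cut splits such a subgraph. The components of
  \<open>T \ T'\<close> are the lower trees of the edges that join \<open>T'\<close> to the rest (\<open>forest_diff_eq\<close>).
\<close>

section \<open>Components\<close>

lemma component_refl [simp]: "x \<in> component E x"
  by (simp add: component_def)

lemma component_step: "y \<in> component E x \<Longrightarrow> {y, z} \<in> E \<Longrightarrow> z \<in> component E x"
  by (auto simp: component_def adj_def intro: rtrancl_into_rtrancl)

lemma component_sym: "y \<in> component E x \<Longrightarrow> x \<in> component E y"
  by (simp add: component_def adj_sym)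

lemma component_trans: "y \<in> component E x \<Longrightarrow> z \<in> component E y \<Longrightarrow> z \<in> component E x"
  by (auto simp: component_def dest: rtrancl_trans)

lemma component_eq: "y \<in> component E x \<Longrightarrow> component E y = component E x"
  using component_trans component_sym by (metis subsetI subset_antisym)

lemma component_induct [consumes 1, case_names base step]:
  assumes "y \<in> component E x" "P x"
    "\<And>y z. y \<in> component E x \<Longrightarrow> P y \<Longrightarrow> {y, z} \<in> E \<Longrightarrow> P z"
  shows "P y"
proof -
  have "(x, y) \<in> (adj E)\<^sup>*" using assms(1) by (simp add: component_def)
  then show ?thesis
    by (induction rule: rtrancl_induct) (use assms(2,3) in \<open>auto simp: component_def adj_def\<close>)
qed

text \<open>A walk from \<open>x\<close> never leaves the component of \<open>x\<close>, so it survives in every edge set that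
  keeps the edges inside this component.\<close>

lemma component_subsetI:
  assumes "\<And>g. g \<in> E \<Longrightarrow> g \<subseteq> component E x \<Longrightarrow> g \<in> E'"
  shows "component E x \<subseteq> component E' x"
proof
  fix y assume "y \<in> component E x"
  then show "y \<in> component E' x"
  proof (induction rule: component_induct)
    case (step y z)
    have "z \<in> component E x" using component_step[OF step(1,2)] .
    then have "{y, z} \<in> E'" using assms step by simp
    then show ?case using component_step step by metis
  qed simp
qed

lemma component_mono: "E \<subseteq> E' \<Longrightarrow> component E x \<subseteq> component E' x"
  by (rule component_subsetI) auto

section \<open>Cutting one edge\<close>

lemma induced_simps [simp]:
  "verts (induced E C r) = C" "edges (induced E C r) = {g\<in>E. g \<subseteq> C}" "root (induced E C r) = r"
  by (simp_all add: induced_def)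

lemma induced_induced: "C' \<subseteq> C \<Longrightarrow> induced {g\<in>E. g \<subseteq> C} C' r = induced E C' r"
  by (auto simp: induced_def)

lemma rooted_treeD:
  assumes "rooted_tree T"
  shows "finite (verts T)" "root T \<in> verts T" "\<And>e. e \<in> edges T \<Longrightarrow> e \<subseteq> verts T"
    "\<And>e. e \<in> edges T \<Longrightarrow> card e = 2" "finite (edges T)"
    "\<And>x. x \<in> verts T \<Longrightarrow> component (edges T) x = verts T"
proof -
  show a: "finite (verts T)" "root T \<in> verts T" "\<And>e. e \<in> edges T \<Longrightarrow> e \<subseteq> verts T"
    "\<And>e. e \<in> edges T \<Longrightarrow> card e = 2"
    using assms by (auto simp: rooted_tree_def is_graph_def)
  show "finite (edges T)" by (rule finite_subset[of _ "Pow (verts T)"]) (use a in auto)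
  fix x assume x: "x \<in> verts T"
  have "component (edges T) x \<subseteq> insert x (verts T)" using a by (intro component_subset) auto
  moreover have "verts T \<subseteq> component (edges T) x"
    using assms x by (auto simp: rooted_tree_def connected_graph_def component_def)
  ultimately show "component (edges T) x = verts T" using x by auto
qed

lemma bridge_component:
  assumes "rooted_tree T" "{u, v} \<in> edges T"
  shows "v \<notin> component (edges T - {{u, v}}) u"
proof -
  have "u \<noteq> v" using rooted_treeD(4)[OF assms] by auto
  then show ?thesis using bridge[OF assms] by (simp add: component_def)
qed

lemma rooted_tree_induced_component:
  assumes T: "rooted_tree T" and E: "E \<subseteq> edges T" and x: "x \<in> verts T"
  shows "rooted_tree (induced E (component E x) x)"
proof -
  let ?C = "component E x" and ?F = "{g\<in>E. g \<subseteq> component E x}"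
  have "?C \<subseteq> insert x (verts T)" using rooted_treeD(3)[OF T] E by (intro component_subset) blast
  then have "finite ?C" using x rooted_treeD[OF T] finite_subset by blast
  moreover have "?C = component ?F x"
    using component_subsetI[of E x ?F] component_mono[of ?F E x] by auto
  then have "connected_graph ?C ?F"
    using component_eq unfolding connected_graph_def component_def
    by (metis component_def mem_Collect_eq component_refl)
  moreover have "\<not> is_cycle ?F vs" for vs
    using T E unfolding rooted_tree_def is_cycle_def by blast
  ultimately show ?thesis
    using rooted_treeD(4)[OF T] E by (auto simp: rooted_tree_def is_graph_def)
qed

text \<open>A walk from the root that ends beyond the edge \<open>{p, c}\<close> has to cross it. So \<open>p\<close> can be
  reached in fewer steps than the end of the walk, and so can \<open>c\<close> unless the walk ends there.
  Applied to shortest walks, this compares depths: it identifies both the far end of an edge and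
  the vertex of a component that is closest to the root.\<close>

lemma walk_passes_edge:
  assumes "(root T, w) \<in> adj (edges T) ^^ n" "w \<notin> component (edges T - {{p, c}}) (root T)"
    "p \<in> component (edges T - {{p, c}}) (root T)"
  shows "(\<exists>m<n. (root T, p) \<in> adj (edges T) ^^ m) \<and>
         (\<exists>m\<le>n. (root T, c) \<in> adj (edges T) ^^ m \<and> (m = n \<longrightarrow> w = c))"
  using assms(1,2)
proof (induction n arbitrary: w)
  case 0
  then show ?case by simp
next
  case (Suc n)
  then obtain y where y: "(root T, y) \<in> adj (edges T) ^^ n" "{y, w} \<in> edges T"
    by (auto simp: adj_def)
  show ?case
  proof (cases "y \<in> component (edges T - {{p, c}}) (root T)")
    case False
    from Suc.IH[OF y(1) this] obtain i j where
      "i < n" "(root T, p) \<in> adj (edges T) ^^ i" "j \<le> n" "(root T, c) \<in> adj (edges T) ^^ j"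
      by blast
    then show ?thesis by (intro conjI exI[of _ i] exI[of _ j]) simp_all
  next
    case True
    then have "{y, w} = {p, c}"
      using component_step[OF True, of w] y Suc.prems by auto
    then have "y = p" "w = c" using assms(3) Suc.prems(2) by (auto simp: doubleton_eq_iff)
    then show ?thesis using y(1) Suc.prems(1) by (intro conjI exI[of _ n] exI[of _ "Suc n"]) simp_all
  qed
qed

lemma depth_walk:
  assumes T: "rooted_tree T" and v: "v \<in> verts T"
  shows "(root T, v) \<in> adj (edges T) ^^ depth T v"
proof -
  have "v \<in> component (edges T) (root T)" using rooted_treeD[OF T] v by simp
  then obtain n where "(root T, v) \<in> adj (edges T) ^^ n"
    by (auto simp: component_def rtrancl_power)
  then show ?thesis unfolding depth_def by (rule LeastI)
qed

lemma depth_le: "(root T, v) \<in> adj (edges T) ^^ n \<Longrightarrow> depth T v \<le> n"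
  by (simp add: depth_def Least_le)

lemma root_in_upper [simp]: "root T \<in> verts (upper T e)" "root (upper T e) = root T"
  by (simp_all add: upper_def)

lemma upper_step:
  "y \<in> verts (upper T e) \<Longrightarrow> {y, z} \<in> edges T \<Longrightarrow> {y, z} \<noteq> e \<Longrightarrow> z \<in> verts (upper T e)"
  by (auto simp: upper_def intro: component_step)

text \<open>By connectedness at least one end of \<open>e\<close> is joined to the root without using \<open>e\<close>, and
  because there is no cycle the other end is not. The other end is the deeper one.
  The far end is given a name of its own, as the equation \<open>e = {p, far_end T e}\<close> would rewrite
  its own right-hand side.\<close>

lemma edge_ends:
  assumes T: "rooted_tree T" and e: "e \<in> edges T"
  obtains p c where "e = {p, c}" "far_end T e = c" "p \<in> verts (upper T e)" "c \<notin> verts (upper T e)"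
proof -
  let ?U = "verts (upper T e)"
  obtain u v where uv: "e = {u, v}" using rooted_treeD[OF T] e by (metis card_2_iff)
  have not_both: "\<not> (u \<in> ?U \<and> v \<in> ?U)"
  proof
    assume "u \<in> ?U \<and> v \<in> ?U"
    then have "v \<in> component (edges T - {{u, v}}) u"
      unfolding upper_def uv using component_sym component_trans by (metis induced_simps(1))
    then show False using bridge_component[OF T] e uv by metis
  qed
  have "y \<in> ?U \<or> u \<in> ?U \<or> v \<in> ?U" if "y \<in> component (edges T) (root T)" for y
    using that
  proof (induction rule: component_induct)
    case (step y z)
    then show ?case using upper_step[of y T e z] uv by (auto simp: doubleton_eq_iff)
  qed simp
  from this[of u] have "u \<in> ?U \<or> v \<in> ?U" using rooted_treeD[OF T] e uv by auto
  then obtain p c where pc: "e = {p, c}" "p \<in> ?U" "c \<notin> ?U"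
    using not_both uv by (metis insert_commute)
  have "c \<in> verts T" using rooted_treeD[OF T] e pc by auto
  from walk_passes_edge[OF depth_walk[OF T this], of p c]
  obtain m where "m < depth T c" "(root T, p) \<in> adj (edges T) ^^ m"
    using pc by (auto simp: upper_def)
  then have less: "depth T p < depth T c" using depth_le by (meson le_less_trans)
  have "far_end T e = c"
    unfolding far_end_def arg_max_on_def arg_max_def
  proof (rule some_equality)
    show "is_arg_max (depth T) (\<lambda>x. x \<in> e) c" using less by (auto simp: pc(1) is_arg_max_def)
    show "x = c" if "is_arg_max (depth T) (\<lambda>x. x \<in> e) x" for x
      using that less unfolding pc(1) is_arg_max_def by blast
  qed
  then show ?thesis by (intro that[OF pc(1) _ pc(2,3)])
qed

lemma far_end_eqI:
  assumes "rooted_tree T" "e \<in> edges T" "x \<in> e" "x \<notin> verts (upper T e)"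
  shows "far_end T e = x"
proof -
  obtain p c where p: "e = {p, c}" "p \<in> verts (upper T e)" and c: "far_end T e = c"
    by (rule edge_ends[OF assms(1,2)])
  have "x = c" using assms(3,4) p by auto
  then show ?thesis using c by simp
qed

lemma verts_upper_subset: "rooted_tree T \<Longrightarrow> verts (upper T e) \<subseteq> verts T"
  using component_mono[of "edges T - {e}" "edges T" "root T"] rooted_treeD(6)[of T "root T"]
    rooted_treeD(2)[of T]
  by (simp add: upper_def)

lemma verts_lower:
  assumes T: "rooted_tree T" and e: "e \<in> edges T"
  shows "verts (lower T e) = verts T - verts (upper T e)"
proof -
  let ?E = "edges T - {e}"
  obtain p c where p: "e = {p, c}" "p \<in> verts (upper T e)" "c \<notin> verts (upper T e)"
    and far: "far_end T e = c"
    by (rule edge_ends[OF T e])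
  have c: "c \<in> verts T" using rooted_treeD[OF T] e p(1) by auto
  have "y \<notin> verts (upper T e)" if "y \<in> component ?E c" for y
    using component_trans[OF _ component_sym[OF that]] p(3) by (auto simp: upper_def)
  moreover have "component ?E c \<subseteq> verts T"
    using component_mono[of ?E "edges T" c] rooted_treeD(6)[OF T c] by auto
  moreover have "y \<in> component ?E c \<or> y \<in> verts (upper T e)"
    if "y \<in> component (edges T) (root T)" for y
    using that
  proof (induction rule: component_induct)
    case (step y z)
    show ?case
    proof (cases "{y, z} = e")
      case True
      then have "z = p \<or> z = c" using p(1) by (auto simp: doubleton_eq_iff)
      then show ?thesis using p by auto
    next
      case False
      then have "{y, z} \<in> ?E" using step by auto
      then show ?thesis using step(2) component_step upper_step False step(3) by metis
    qed
  qed simp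
  ultimately show ?thesis using rooted_treeD(6)[OF T rooted_treeD(2)[OF T]]
    unfolding lower_def far induced_simps by blast
qed

text \<open>Both pieces are the subgraphs of \<open>T\<close> induced on complementary vertex sets. From here on
  an identity between iterated cuts becomes an identity between subsets of \<open>verts T\<close>.\<close>

lemma upper_eq_induced:
  assumes "rooted_tree T" "e \<in> edges T"
  shows "upper T e = induced (edges T) (verts (upper T e)) (root T)"
  by (rule edge_ends[OF assms]) (auto simp: upper_def induced_def)

lemma lower_eq_induced:
  assumes "rooted_tree T" "e \<in> edges T"
  shows "lower T e = induced (edges T) (verts T - verts (upper T e)) (far_end T e)"
proof -
  obtain p c where "e = {p, c}" "p \<in> verts (upper T e)"
    by (rule edge_ends[OF assms])
  then have "\<not> e \<subseteq> verts (lower T e)" using verts_lower[OF assms] by auto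
  then show ?thesis unfolding verts_lower[OF assms, symmetric]
    by (auto simp: lower_def induced_def)
qed

lemma edges_upper:
  assumes "rooted_tree T" "e \<in> edges T"
  shows "edges (upper T e) = {g\<in>edges T. g \<subseteq> verts (upper T e)}"
  by (subst upper_eq_induced[OF assms]) simp

lemma edges_lower:
  assumes "rooted_tree T" "e \<in> edges T"
  shows "edges (lower T e) = {g\<in>edges T. g \<subseteq> verts T - verts (upper T e)}"
  by (subst lower_eq_induced[OF assms]) simp

lemma rooted_tree_upper: "rooted_tree T \<Longrightarrow> rooted_tree (upper T e)"
  unfolding upper_def by (rule rooted_tree_induced_component) (auto dest: rooted_treeD)

lemma rooted_tree_lower:
  assumes "rooted_tree T" "e \<in> edges T" shows "rooted_tree (lower T e)"
proof -
  have "far_end T e \<in> verts T"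
    by (rule edge_ends[OF assms]) (use rooted_treeD(3)[OF assms] in auto)
  then show ?thesis unfolding lower_def using assms
    by (intro rooted_tree_induced_component) auto
qed

lemma card_upper_less: "rooted_tree T \<Longrightarrow> e \<in> edges T \<Longrightarrow> card (verts (upper T e)) < card (verts T)"
  using component_card_less[of T e "root T"] rooted_treeD(2)[of T] by (simp add: upper_def)

section \<open>Cutting two edges\<close>

text \<open>Cutting \<open>e\<close> in an induced subtree \<open>S\<close> splits the vertex set of \<open>S\<close> in the same way as
  cutting \<open>e\<close> in \<open>T\<close>: a vertex of \<open>S\<close> that is joined to \<open>r\<close> in \<open>T\<close> without \<open>e\<close> but not so in
  \<open>S\<close> would yield a connection between the two ends of \<open>e\<close> that avoids \<open>e\<close>. The hypothesis on
  \<open>r\<close> says that \<open>S\<close> and \<open>T\<close> agree on which side of \<open>e\<close> is the upper one.\<close>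

lemma cut_induced:
  assumes T: "rooted_tree T" and S: "S = induced (edges T) C r" "rooted_tree S"
    and e: "e \<in> edges S" and r: "r \<in> verts (upper T e)"
  shows "upper S e = induced (edges T) (C \<inter> verts (upper T e)) r"
    "lower S e = induced (edges T) (C - verts (upper T e)) (far_end T e)"
proof -
  let ?E = "edges T - {e}" and ?F = "edges S - {e}"
  have eT: "e \<in> edges T" and FE: "?F \<subseteq> ?E" and [simp]: "verts S = C" "root S = r"
    using e S by auto
  have U: "verts (upper T e) = component ?E r"
    using r component_eq[of r ?E "root T"] by (simp add: upper_def)
  have US: "verts (upper S e) = component ?F r" by (simp add: upper_def)
  obtain p c where p: "e = {p, c}" "p \<in> verts (upper S e)" and cS: "far_end S e = c"
    by (rule edge_ends[OF S(2) e])
  have pU: "p \<in> component ?E r" using p(2) component_mono[OF FE, of r] US by auto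
  have far: "c \<notin> component ?E r"
    using bridge_component[OF T, of p c] eT p(1) component_eq[OF pU] by auto
  have "component ?F r = C \<inter> component ?E r"
  proof (intro equalityI subsetI)
    fix w assume "w \<in> component ?F r"
    then show "w \<in> C \<inter> component ?E r"
      using component_mono[OF FE, of r] verts_upper_subset[OF S(2), of e] US by auto
  next
    fix w assume w: "w \<in> C \<inter> component ?E r"
    show "w \<in> component ?F r"
    proof (rule ccontr)
      assume "w \<notin> component ?F r"
      then have "w \<in> verts (lower S e)" using verts_lower[OF S(2) e] w US by auto
      then have "w \<in> component ?E c"
        using component_mono[OF FE] by (auto simp: lower_def cS)
      then show False using far w component_sym component_trans by (metis IntD2)
    qed
  qed
  then have V: "verts (upper S e) = C \<inter> verts (upper T e)" using U US by simp
  have "far_end T e = far_end S e"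
    using far U p(1) cS by (intro far_end_eqI[OF T eT]) simp_all
  moreover have "C - C \<inter> verts (upper T e) = C - verts (upper T e)" by auto
  ultimately show "upper S e = induced (edges T) (C \<inter> verts (upper T e)) r"
    "lower S e = induced (edges T) (C - verts (upper T e)) (far_end T e)"
    using upper_eq_induced[OF S(2) e] lower_eq_induced[OF S(2) e] V S(1)
    by (simp_all add: induced_induced)
qed

text \<open>This is what makes chains recursive: after the first cut, the relation \<open>\<succ>\<close> of the tree
  \<open>upper T e\<close> is the restriction of that of \<open>T\<close>.\<close>

lemma edges_upper_upper:
  assumes T: "rooted_tree T" and e: "e \<in> edges T" and f: "f \<in> edges (upper T e)"
  shows "edges (upper (upper T e) f) = edges (upper T e) \<inter> edges (upper T f)"
proof -
  have fT: "f \<in> edges T" using f edges_upper[OF T e] by auto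
  show ?thesis
    using cut_induced(1)[OF T upper_eq_induced[OF T e] rooted_tree_upper[OF T] f]
    by (auto simp: edges_upper[OF T e] edges_upper[OF T fT])
qed

text \<open>If \<open>e\<close> is not below \<open>f\<close>, no walk below \<open>f\<close> can use it, so everything below \<open>f\<close> stays
  above \<open>e\<close> and the cut at \<open>e\<close> does not touch the lower tree of \<open>f\<close>.\<close>

lemma lower_upper_unaffected:
  assumes T: "rooted_tree T" and e: "e \<in> edges T" and f: "f \<in> edges (upper T e)"
    and ne: "e \<notin> edges (lower T f)"
  shows "lower (upper T e) f = lower T f"
proof -
  have fT: "f \<in> edges T" and fU: "f \<subseteq> verts (upper T e)" using f edges_upper[OF T e] by auto
  have "component (edges T - {f}) (far_end T f) \<subseteq> verts (upper T e)"
  proof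
    fix w assume "w \<in> component (edges T - {f}) (far_end T f)"
    then show "w \<in> verts (upper T e)"
    proof (induction rule: component_induct)
      case base
      show ?case by (rule edge_ends[OF T fT]) (use fU in simp)
    next
      case (step y z)
      have "{y, z} \<subseteq> component (edges T - {f}) (far_end T f)"
        using step component_step by (metis insert_subset empty_subsetI)
      then have "{y, z} \<noteq> e" using ne step by (auto simp: lower_def)
      then show ?case using upper_step step by (metis DiffD1)
    qed
  qed
  then have "verts (upper T e) - verts (upper T f) = verts T - verts (upper T f)"
    using verts_lower[OF T fT] verts_upper_subset[OF T, of e] by (auto simp: lower_def)
  then show ?thesis
    using cut_induced(2)[OF T upper_eq_induced[OF T e] rooted_tree_upper[OF T] f]
      lower_eq_induced[OF T fT] by simp
qed

text \<open>If \<open>e\<close> lies below \<open>f\<close>, the two cuts can be made in either order, with the same three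
  pieces as a result.\<close>

lemma nested_cuts:
  assumes T: "rooted_tree T" and f: "f \<in> edges T" and e: "e \<in> edges (lower T f)"
  shows "f \<in> edges (upper T e)" "lower (lower T f) e = lower T e"
    "lower (upper T e) f = upper (lower T f) e"
proof -
  have eT: "e \<in> edges T" and eD: "e \<inter> verts (upper T f) = {}"
    using e edges_lower[OF T f] by auto
  have "e \<noteq> {}" using rooted_treeD(4)[OF T eT] by auto
  have "component (edges T - {f}) (root T) \<subseteq> component (edges T - {e}) (root T)"
    by (rule component_subsetI) (use eD \<open>e \<noteq> {}\<close> in \<open>auto simp: upper_def\<close>)
  then have UU: "verts (upper T f) \<subseteq> verts (upper T e)" by (simp add: upper_def)
  \<comment> \<open>The far end of \<open>f\<close>, which is the root of \<open>lower T f\<close>, is above \<open>e\<close>.\<close>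
  obtain p c where p: "f = {p, c}" "far_end T f = c" "p \<in> verts (upper T f)"
    by (rule edge_ends[OF T f])
  have fe: "f \<noteq> e" using p eD by auto
  then have far: "far_end T f \<in> verts (upper T e)"
    using upper_step[of p T e c] p f UU by auto
  then show fU: "f \<in> edges (upper T e)" using edges_upper[OF T eT] f p UU by auto
  note cut = cut_induced[OF T lower_eq_induced[OF T f] rooted_tree_lower[OF T f] e far]
  have "verts T - verts (upper T f) - verts (upper T e) = verts T - verts (upper T e)"
    using UU by auto
  then show "lower (lower T f) e = lower T e"
    using cut(2) lower_eq_induced[OF T eT] by simp
  have "(verts T - verts (upper T f)) \<inter> verts (upper T e) = verts (upper T e) - verts (upper T f)"
    using verts_upper_subset[OF T, of e] by auto
  then show "lower (upper T e) f = upper (lower T f) e"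
    using cut(1) cut_induced(2)[OF T upper_eq_induced[OF T eT] rooted_tree_upper[OF T] fU]
    by simp
qed

section \<open>The derivative of $\psi_T$\<close>

text \<open>The value at \<open>T\<close> of the convolution power $\phi^{*(n+1)}$.\<close>

definition chain_sum :: "'a rgraph \<Rightarrow> nat \<Rightarrow> rat" where
  "chain_sum T n = (\<Sum>es \<in> edge_chains T n. prod_list (map phi (cut_trees T es)))"

lemma edge_chains_0: "edge_chains T 0 = {[]}"
  by (auto simp: edge_chains_def)

lemma edge_chains_Suc:
  assumes T: "rooted_tree T"
  shows "edge_chains T (Suc n) = (\<Union>e\<in>edges T. Cons e ` edge_chains (upper T e) n)"
proof -
  have iff: "e # es \<in> edge_chains T (Suc n) \<longleftrightarrow> es \<in> edge_chains (upper T e) n"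
    if e: "e \<in> edges T" for e es
  proof -
    have sub: "edges (upper T e) \<subseteq> edges T" using edges_upper[OF T e] by auto
    have succ: "edge_succ T f g = edge_succ (upper T e) f g"
      if "f \<in> edges (upper T e)" "g \<in> edges (upper T e)" for f g
      using that edges_upper_upper[OF T e] by (simp add: edge_succ_def)
    have "sorted_wrt (edge_succ T) es = sorted_wrt (edge_succ (upper T e)) es"
      if "set es \<subseteq> edges (upper T e)"
      using that succ
      by (intro iffI; elim sorted_wrt_mono_rel[rotated]) (simp_all add: subset_iff)
    then show ?thesis
      unfolding edge_chains_def using e sub by (auto simp: edge_succ_def[of T e])
  qed
  show ?thesis
  proof (rule set_eqI)
    fix xs
    show "xs \<in> edge_chains T (Suc n) \<longleftrightarrow> xs \<in> (\<Union>e\<in>edges T. Cons e ` edge_chains (upper T e) n)"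
    proof (cases xs)
      case Nil
      then show ?thesis by (auto simp: edge_chains_def)
    next
      case (Cons e es)
      have "e \<in> edges T" if "xs \<in> edge_chains T (Suc n)"
        using that Cons by (simp add: edge_chains_def)
      then show ?thesis using iff Cons by auto
    qed
  qed
qed

lemma finite_edge_chains:
  assumes "rooted_tree T" shows "finite (edge_chains T n)"
  by (rule finite_subset[OF _ finite_lists_length_eq[OF rooted_treeD(5)[OF assms], of n]])
     (auto simp: edge_chains_def)

lemma chain_sum_0: "chain_sum T 0 = phi T"
  by (simp add: chain_sum_def edge_chains_0)

lemma chain_sum_Suc:
  assumes T: "rooted_tree T"
  shows "chain_sum T (Suc n) = (\<Sum>e\<in>edges T. phi (lower T e) * chain_sum (upper T e) n)"
proof -
  have "chain_sum T (Suc n) =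
      (\<Sum>e\<in>edges T. \<Sum>xs \<in> Cons e ` edge_chains (upper T e) n. prod_list (map phi (cut_trees T xs)))"
    unfolding chain_sum_def edge_chains_Suc[OF T]
    by (rule sum.UNION_disjoint)
       (use rooted_treeD(5)[OF T] finite_edge_chains[OF rooted_tree_upper[OF T]] in auto)
  also have "\<dots> = (\<Sum>e\<in>edges T. phi (lower T e) * chain_sum (upper T e) n)"
    by (simp add: sum.reindex chain_sum_def sum_distrib_left)
  finally show ?thesis .
qed

lemma chain_sum_eq_0:
  assumes "rooted_tree T" "card (verts T) \<le> n"
  shows "chain_sum T n = 0"
  using assms
proof (induction n arbitrary: T)
  case 0
  then show ?case using rooted_treeD(1,2)[OF 0(1)] by auto
next
  case (Suc n)
  have "chain_sum (upper T e) n = 0" if "e \<in> edges T" for e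
    using Suc.IH[OF rooted_tree_upper[OF Suc.prems(1)], of e]
      card_upper_less[OF Suc.prems(1) that] Suc.prems(2) by simp
  then show ?case by (simp add: chain_sum_Suc[OF Suc.prems(1)])
qed

text \<open>Since chains have fewer edges than the tree has vertices, one formula gives the
  coefficients for all \<open>k\<close>. This allows comparing trees of different sizes coefficientwise.\<close>

lemma coeff_psi:
  assumes "rooted_tree T"
  shows "coeff (psi T) k = (if k = 0 then 0 else chain_sum T (k - 1) / fact k)"
proof -
  have "coeff (psi T) k = (\<Sum>j = 1..card (verts T). if j = k then 1 / fact k * chain_sum T (k - 1) else 0)"
    unfolding psi_def chain_sum_def[symmetric] coeff_sum by (intro sum.cong) auto
  also have "\<dots> = (if k \<in> {1..card (verts T)} then 1 / fact k * chain_sum T (k - 1) else 0)"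
    by (simp add: sum.delta)
  finally show ?thesis using chain_sum_eq_0[OF assms, of "k - 1"] by auto
qed

text \<open>Differentiating $t^k/k!$ lowers \<open>k\<close> by one, and a chain is its first edge followed by a
  chain of the upper tree. In the language of Hopf algebras, $\psi(t)$ is the convolution
  exponential of $t\phi$, and this is the equation $\psi' = \phi * \psi$; only cuts at a single
  edge occur because $\phi$ is extended by zero to forests with several components.\<close>

lemma pderiv_psi:
  assumes T: "rooted_tree T"
  shows "pderiv (psi T) = [:phi T:] + (\<Sum>e\<in>edges T. smult (phi (lower T e)) (psi (upper T e)))"
proof (rule poly_eqI)
  fix k
  have "coeff (pderiv (psi T)) k = chain_sum T k / fact k"
    by (simp add: coeff_pderiv coeff_psi[OF T] fact_Suc del: of_nat_Suc)
  also have "\<dots> = coeff ([:phi T:] + (\<Sum>e\<in>edges T. smult (phi (lower T e)) (psi (upper T e)))) k"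
  proof (cases k)
    case 0
    then show ?thesis
      by (simp add: chain_sum_0 coeff_sum coeff_psi[OF rooted_tree_upper[OF T]])
  next
    case (Suc n)
    then show ?thesis
      by (simp add: chain_sum_Suc[OF T] coeff_sum coeff_psi[OF rooted_tree_upper[OF T]]
          sum_divide_distrib)
  qed
  finally show "coeff (pderiv (psi T)) k = \<dots>" .
qed

lemma poly_psi_0: "rooted_tree T \<Longrightarrow> poly (psi T) 0 = 0"
  by (simp add: poly_0_coeff_0 coeff_psi)

section \<open>The forest left by a rooted subtree\<close>

text \<open>The edges that join \<open>S\<close> to the rest of \<open>T\<close>. The trees below them are the components of
  the forest \<open>T \ S\<close>; this index set turns the product over the forest into one over edges.\<close>

definition boundary :: "'a rgraph \<Rightarrow> 'a rgraph \<Rightarrow> 'a set set" where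
  "boundary T S = {f\<in>edges T. f \<inter> verts S \<noteq> {} \<and> \<not> f \<subseteq> verts S}"

lemma finite_boundary: "rooted_tree T \<Longrightarrow> finite (boundary T S)"
  using rooted_treeD(5)[of T] by (simp add: boundary_def)

lemma rooted_subtree_edges: "rooted_subtree S T \<Longrightarrow> g \<in> edges S \<Longrightarrow> g \<subseteq> verts S"
  by (auto simp: rooted_subtree_def is_graph_def)

lemma subtree_verts_upper:
  assumes S: "rooted_subtree S T" and e: "e \<notin> edges S"
  shows "verts S \<subseteq> verts (upper T e)"
proof
  fix v assume "v \<in> verts S"
  then have "v \<in> component (edges S) (root T)"
    using S by (auto simp: rooted_subtree_def connected_graph_def component_def)
  moreover have "edges S \<subseteq> edges T - {e}" using S e by (auto simp: rooted_subtree_def)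
  ultimately show "v \<in> verts (upper T e)"
    using component_mono[of "edges S" "edges T - {e}" "root T"] by (auto simp: upper_def)
qed

text \<open>A rooted subtree without the edge \<open>e\<close> joins all its vertices to the root without \<open>e\<close>, so it
  lies above \<open>e\<close>. This equivalence permits the exchange of the sums over edges and over
  subtrees.\<close>

lemma subtree_upper_iff:
  assumes T: "rooted_tree T" and e: "e \<in> edges T"
  shows "rooted_subtree S (upper T e) \<longleftrightarrow> rooted_subtree S T \<and> e \<notin> edges S"
proof
  assume S: "rooted_subtree S (upper T e)"
  have "edges (upper T e) \<subseteq> edges T - {e}" by (auto simp: upper_def)
  then show "rooted_subtree S T \<and> e \<notin> edges S"
    using S verts_upper_subset[OF T, of e] by (auto simp: rooted_subtree_def)
next
  assume S: "rooted_subtree S T \<and> e \<notin> edges S"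
  then have "verts S \<subseteq> verts (upper T e)" using subtree_verts_upper by blast
  moreover from this have "edges S \<subseteq> edges (upper T e)"
    using rooted_subtree_edges[of S T] S edges_upper[OF T e]
    by (auto simp: rooted_subtree_def)
  ultimately show "rooted_subtree S (upper T e)"
    using S by (auto simp: rooted_subtree_def)
qed

text \<open>Otherwise the subtree would join the ends of \<open>e\<close> without using \<open>e\<close>.\<close>

lemma edge_within_subtree:
  assumes T: "rooted_tree T" and S: "rooted_subtree S T" and e: "e \<in> edges T" "e \<subseteq> verts S"
  shows "e \<in> edges S"
proof (rule ccontr)
  assume "e \<notin> edges S"
  then have sub: "e \<subseteq> verts (upper T e)" using subtree_verts_upper[OF S] e by blast
  obtain p c where "e = {p, c}" "c \<notin> verts (upper T e)" by (rule edge_ends[OF T e(1)])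
  then show False using sub by auto
qed

lemma boundary_upper_subset:
  assumes S: "rooted_subtree S T" and f: "f \<in> boundary T S"
  shows "verts S \<subseteq> verts (upper T f)"
  using subtree_verts_upper[OF S] rooted_subtree_edges[OF S] f by (auto simp: boundary_def)

lemma boundary_ends:
  assumes T: "rooted_tree T" and S: "rooted_subtree S T" and f: "f \<in> boundary T S"
  obtains p c where "f = {p, c}" "far_end T f = c" "p \<in> verts S" "c \<notin> verts (upper T f)"
proof -
  have fT: "f \<in> edges T" using f by (simp add: boundary_def)
  obtain p c where p: "f = {p, c}" and far: "far_end T f = c" and c: "c \<notin> verts (upper T f)"
    by (rule edge_ends[OF T fT])
  have "p \<in> verts S" using f p c boundary_upper_subset[OF S f] by (auto simp: boundary_def)
  then show ?thesis by (rule that[OF p far _ c])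
qed

text \<open>Walking from the root to \<open>v\<close>, once the walk has left \<open>S\<close> through a boundary edge \<open>f\<close> it
  stays below \<open>f\<close> until it returns to \<open>S\<close>.\<close>

lemma boundary_cover:
  assumes T: "rooted_tree T" and S: "rooted_subtree S T" and v: "v \<in> verts T" "v \<notin> verts S"
  shows "\<exists>f\<in>boundary T S. v \<in> verts (lower T f)"
proof -
  have "v \<in> component (edges T) (root T)" using rooted_treeD(2,6)[OF T] v by simp
  then have "v \<in> verts S \<or> (\<exists>f\<in>boundary T S. v \<in> verts (lower T f))"
  proof (induction rule: component_induct)
    case base
    then show ?case using S by (simp add: rooted_subtree_def)
  next
    case (step y z)
    show ?case
    proof (cases "z \<in> verts S")
      case z: False
      show ?thesis
      proof (cases "y \<in> verts S")
        case True
        then have b: "{y, z} \<in> boundary T S" using z step(2) by (auto simp: boundary_def)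
        obtain p c where p: "{y, z} = {p, c}" "p \<in> verts S" and far: "far_end T {y, z} = c"
          by (rule boundary_ends[OF T S b])
        have "z = c" using p z by (auto simp: doubleton_eq_iff)
        then have "z \<in> verts (lower T {y, z})" using far by (simp add: lower_def)
        then show ?thesis using b by blast
      next
        case y: False
        then obtain f where f: "f \<in> boundary T S" "y \<in> verts (lower T f)" using step(3) by auto
        have "{y, z} \<noteq> f" using y z f(1) by (auto simp: boundary_def)
        then have "z \<in> verts (lower T f)"
          using f(2) step(2) by (auto simp: lower_def intro: component_step)
        then show ?thesis using f(1) by blast
      qed
    qed simp
  qed
  then show ?thesis using v by simp
qed

lemma lower_disjoint_subtree:
  assumes T: "rooted_tree T" and S: "rooted_subtree S T" and f: "f \<in> boundary T S"
  shows "verts (lower T f) \<inter> verts S = {}"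
  using boundary_upper_subset[OF S f] verts_lower[OF T, of f] f by (auto simp: boundary_def)

text \<open>The far end of \<open>g\<close> is reached from \<open>S\<close> through \<open>g\<close>, hence without \<open>f\<close>; from there no
  walk below \<open>g\<close> can use \<open>f\<close>, because \<open>f\<close> touches \<open>S\<close>. So all of \<open>lower T g\<close> is above \<open>f\<close>.\<close>

lemma boundary_lower_disjoint:
  assumes T: "rooted_tree T" and S: "rooted_subtree S T"
    and f: "f \<in> boundary T S" and g: "g \<in> boundary T S" and fg: "f \<noteq> g"
  shows "verts (lower T f) \<inter> verts (lower T g) = {}"
proof -
  obtain p c where p: "g = {p, c}" "p \<in> verts S" and far: "far_end T g = c"
    by (rule boundary_ends[OF T S g])
  have gT: "g \<in> edges T" and fT: "f \<in> edges T" using f g by (auto simp: boundary_def)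
  have "w \<in> verts (upper T f)" if "w \<in> component (edges T - {g}) c" for w
    using that
  proof (induction rule: component_induct)
    case base
    show ?case using upper_step[of p T f c] boundary_upper_subset[OF S f] p gT fg by auto
  next
    case (step y z)
    have "{y, z} \<subseteq> verts (lower T g)"
      using step(1) component_step[OF step(1,2)] by (simp add: lower_def far)
    then have "{y, z} \<noteq> f" using lower_disjoint_subtree[OF T S g] f by (auto simp: boundary_def)
    then show ?case using upper_step[OF step(3)] step(2) by auto
  qed
  then show ?thesis unfolding verts_lower[OF T fT] by (auto simp: lower_def far)
qed

text \<open>An edge that is not in \<open>S\<close> either touches \<open>S\<close>, and is then a boundary edge, or lies
  inside one component of the forest. By \<open>boundary_meets_lower\<close> and
  \<open>boundary_edges_disjoint\<close> below, the union is disjoint.\<close>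

lemma edges_outside_subtree:
  assumes T: "rooted_tree T" and S: "rooted_subtree S T"
  shows "edges T - edges S = (\<Union>f\<in>boundary T S. insert f (edges (lower T f)))"
proof (intro equalityI subsetI)
  fix e assume e: "e \<in> edges T - edges S"
  then obtain u v where uv: "e = {u, v}" using rooted_treeD(4)[OF T] by (metis DiffD1 card_2_iff)
  have nS: "\<not> e \<subseteq> verts S" using edge_within_subtree[OF T S] e by blast
  show "e \<in> (\<Union>f\<in>boundary T S. insert f (edges (lower T f)))"
  proof (cases "e \<inter> verts S = {}")
    case False
    then show ?thesis using e nS by (auto simp: boundary_def)
  next
    case True
    then obtain f where f: "f \<in> boundary T S" "u \<in> verts (lower T f)"
      using boundary_cover[OF T S, of u] uv rooted_treeD(3)[OF T] e by blast
    then have ef: "e \<in> edges T - {f}" using e True by (auto simp: boundary_def)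
    then have "v \<in> verts (lower T f)"
      using f(2) uv by (auto simp: lower_def intro: component_step)
    then have "e \<in> edges (lower T f)" using f(2) uv ef by (simp add: lower_def)
    then show ?thesis using f(1) by blast
  qed
next
  fix e assume "e \<in> (\<Union>f\<in>boundary T S. insert f (edges (lower T f)))"
  then obtain f where f: "f \<in> boundary T S" "e = f \<or> e \<in> edges (lower T f)" by blast
  then show "e \<in> edges T - edges S"
  proof (cases "e = f")
    case True
    then show ?thesis using f(1) rooted_subtree_edges[OF S] by (auto simp: boundary_def)
  next
    case False
    then have e: "e \<in> edges T" "e \<subseteq> verts (lower T f)" using f(2) by (auto simp: lower_def)
    then have "e \<inter> verts S = {}" "e \<noteq> {}"
      using lower_disjoint_subtree[OF T S f(1)] rooted_treeD(4)[OF T e(1)] by auto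
    then show ?thesis using e rooted_subtree_edges[OF S, of e] by auto
  qed
qed

lemma boundary_meets_lower:
  assumes T: "rooted_tree T" and S: "rooted_subtree S T"
    and f: "f \<in> boundary T S" and g: "g \<in> boundary T S"
  shows "g \<notin> edges (lower T f)"
  using lower_disjoint_subtree[OF T S f] g by (auto simp: boundary_def lower_def)

lemma boundary_edges_disjoint:
  assumes T: "rooted_tree T" and S: "rooted_subtree S T"
    and f: "f \<in> boundary T S" and g: "g \<in> boundary T S" and fg: "f \<noteq> g"
  shows "edges (lower T f) \<inter> edges (lower T g) = {}"
proof -
  have "e \<noteq> {}" if "e \<in> edges (lower T f)" for e
    using that rooted_treeD(4)[OF T, of e] by (auto simp: lower_def)
  then show ?thesis using boundary_lower_disjoint[OF assms] by (auto simp: lower_def)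
qed

text \<open>Two things are to be checked: removing \<open>verts S\<close> and removing the boundary edge \<open>f\<close> leave
  the same component around the far end of \<open>f\<close>, and this far end is the only vertex of least
  depth in it.\<close>

lemma forest_diff_eq:
  assumes T: "rooted_tree T" and S: "rooted_subtree S T"
  shows "forest_diff T S = lower T ` boundary T S"
proof -
  define E where "E = {f\<in>edges T. f \<inter> verts S = {}}"
  have comp: "component E v = verts (lower T f)"
    and ind: "induced E (verts (lower T f)) (arg_min_on (depth T) (verts (lower T f))) = lower T f"
    if f: "f \<in> boundary T S" and v: "v \<in> verts (lower T f)" for f v
  proof -
    obtain p c where p: "f = {p, c}" "p \<in> verts S" "c \<notin> verts (upper T f)"
      and far: "far_end T f = c"
      by (rule boundary_ends[OF T S f])
    have L: "verts (lower T f) = component (edges T - {f}) c" by (simp add: lower_def far)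
    have EE: "E \<subseteq> edges T - {f}" using f by (auto simp: E_def boundary_def)
    have in_E: "g \<in> E" if "g \<in> edges T - {f}" "g \<subseteq> verts (lower T f)" for g
      using that lower_disjoint_subtree[OF T S f] by (auto simp: E_def)
    have Ec: "component E c = verts (lower T f)"
      unfolding L using component_mono[OF EE] component_subsetI[of "edges T - {f}" c E] in_E L
      by blast
    then show "component E v = verts (lower T f)" using component_eq[of v E c] v by simp
    have less: "depth T c < depth T w" if w: "w \<in> verts (lower T f)" "w \<noteq> c" for w
    proof -
      have fT: "f \<in> edges T" using f by (simp add: boundary_def)
      have w': "w \<in> verts T" "w \<notin> verts (upper T f)" using w verts_lower[OF T fT] by auto
      have "p \<in> verts (upper T f)" using p boundary_upper_subset[OF S f] by blast
      then obtain m where "m \<le> depth T w" "(root T, c) \<in> adj (edges T) ^^ m" "m \<noteq> depth T w"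
        using walk_passes_edge[OF depth_walk[OF T w'(1)], of p c] w' w(2) p(1)
        by (auto simp: upper_def)
      then show ?thesis using depth_le[of T c m] by simp
    qed
    have "arg_min_on (depth T) (verts (lower T f)) = c"
      unfolding arg_min_on_def arg_min_def
    proof (rule some_equality)
      show "is_arg_min (depth T) (\<lambda>x. x \<in> verts (lower T f)) c"
        using less by (auto simp: is_arg_min_def L dest: less_asym)
      show "x = c" if "is_arg_min (depth T) (\<lambda>x. x \<in> verts (lower T f)) x" for x
        using that less[of x] unfolding is_arg_min_def L by (metis component_refl)
    qed
    moreover have "{g\<in>E. g \<subseteq> verts (lower T f)} = {g\<in>edges T - {f}. g \<subseteq> verts (lower T f)}"
      using in_E EE by auto
    ultimately show "induced E (verts (lower T f)) (arg_min_on (depth T) (verts (lower T f))) = lower T f"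
      unfolding induced_def by (simp add: lower_def far induced_def)
  qed
  have ne: "\<exists>v. v \<in> verts (lower T f)" for f
    by (intro exI[of _ "far_end T f"]) (simp add: lower_def)
  have sub: "verts (lower T f) \<subseteq> verts T - verts S" if "f \<in> boundary T S" for f
    using lower_disjoint_subtree[OF T S that] verts_lower[OF T, of f] that
    by (auto simp: boundary_def)
  have "forest_diff T S = {induced E C (arg_min_on (depth T) C) | C. \<exists>v\<in>verts T - verts S. C = component E v}"
    by (simp add: forest_diff_def Let_def E_def)
  also have "\<dots> = lower T ` boundary T S"
  proof (intro equalityI subsetI)
    fix R assume "R \<in> {induced E C (arg_min_on (depth T) C) | C. \<exists>v\<in>verts T - verts S. C = component E v}"
    then obtain v where v: "v \<in> verts T" "v \<notin> verts S"
      and R: "R = induced E (component E v) (arg_min_on (depth T) (component E v))" by blast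
    obtain f where "f \<in> boundary T S" "v \<in> verts (lower T f)"
      using boundary_cover[OF T S v] by blast
    then show "R \<in> lower T ` boundary T S" using comp ind R by simp
  next
    fix R assume "R \<in> lower T ` boundary T S"
    then obtain f where f: "f \<in> boundary T S" "R = lower T f" by blast
    obtain v where v: "v \<in> verts (lower T f)" using ne by blast
    have "R = induced E (component E v) (arg_min_on (depth T) (component E v))"
      using comp[OF f(1) v] ind[OF f(1) v] f(2) by simp
    moreover have "v \<in> verts T - verts S" using sub[OF f(1)] v by auto
    ultimately show "R \<in> {induced E C (arg_min_on (depth T) C) | C. \<exists>v\<in>verts T - verts S. C = component E v}"
      by blast
  qed
  finally show ?thesis .
qed

lemma psi_forest_diff:
  assumes T: "rooted_tree T" and S: "rooted_subtree S T"
  shows "psi_forest (forest_diff T S) = (\<Prod>f\<in>boundary T S. psi (lower T f))"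
proof -
  have "far_end T f \<in> verts (lower T f)" for f by (simp add: lower_def)
  then have "inj_on (lower T) (boundary T S)"
    using boundary_lower_disjoint[OF T S] by (intro inj_onI) (metis disjoint_iff)
  then show ?thesis by (simp add: psi_forest_def forest_diff_eq[OF T S] prod.reindex)
qed

lemma boundary_upper:
  assumes T: "rooted_tree T" and S: "rooted_subtree S T" and e: "e \<in> edges T - edges S"
  shows "boundary (upper T e) S = boundary T S - {e}"
proof -
  have eT: "e \<in> edges T" using e by simp
  have "g \<in> edges (upper T e)" if g: "g \<in> boundary T S" "g \<noteq> e" for g
  proof -
    obtain p c where p: "g = {p, c}" "p \<in> verts S" by (rule boundary_ends[OF T S g(1)])
    have "p \<in> verts (upper T e)" using subtree_verts_upper[OF S] e p by blast
    then show ?thesis using upper_step[of p T e c] g p edges_upper[OF T eT]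
      by (auto simp: boundary_def)
  qed
  then show ?thesis by (auto simp: boundary_def upper_def)
qed

text \<open>Cutting a boundary edge removes the whole component below it from the forest.\<close>

lemma psi_forest_cut_boundary:
  assumes T: "rooted_tree T" and S: "rooted_subtree S T" and f: "f \<in> boundary T S"
  shows "psi_forest (forest_diff (upper T f) S) = (\<Prod>g\<in>boundary T S - {f}. psi (lower T g))"
proof -
  have fT: "f \<in> edges T" and out: "f \<in> edges T - edges S"
    using f edges_outside_subtree[OF T S] by (auto simp: boundary_def)
  have S': "rooted_subtree S (upper T f)" using subtree_upper_iff[OF T fT] S out by simp
  have "lower (upper T f) g = lower T g" if g: "g \<in> boundary T S - {f}" for g
  proof (rule lower_upper_unaffected[OF T fT])
    show "g \<in> edges (upper T f)" using boundary_upper[OF T S out] g by (auto simp: boundary_def)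
    show "f \<notin> edges (lower T g)" using boundary_meets_lower[OF T S _ f] g by simp
  qed
  then show ?thesis
    unfolding psi_forest_diff[OF rooted_tree_upper[OF T] S'] boundary_upper[OF T S out]
    by (intro prod.cong) auto
qed

text \<open>Cutting an edge inside a component of the forest shortens this component and leaves the
  others alone.\<close>

lemma psi_forest_cut_inner:
  assumes T: "rooted_tree T" and S: "rooted_subtree S T" and f: "f \<in> boundary T S"
    and e: "e \<in> edges (lower T f)"
  shows "psi_forest (forest_diff (upper T e) S) =
    (\<Prod>g\<in>boundary T S - {f}. psi (lower T g)) * psi (upper (lower T f) e)"
proof -
  have fT: "f \<in> edges T" using f by (simp add: boundary_def)
  have out: "e \<in> edges T - edges S" using f e edges_outside_subtree[OF T S] by blast
  then have eT: "e \<in> edges T" by simp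
  have S': "rooted_subtree S (upper T e)" using subtree_upper_iff[OF T eT] S out by simp
  have "e \<notin> boundary T S" using boundary_meets_lower[OF T S f] e by blast
  then have b: "boundary (upper T e) S = boundary T S" using boundary_upper[OF T S out] by simp
  have "lower (upper T e) g = lower T g" if g: "g \<in> boundary T S - {f}" for g
  proof (rule lower_upper_unaffected[OF T eT])
    show "g \<in> edges (upper T e)" using b g by (auto simp: boundary_def)
    show "e \<notin> edges (lower T g)" using boundary_edges_disjoint[OF T S f, of g] g e by blast
  qed
  then have "(\<Prod>g\<in>boundary T S - {f}. psi (lower (upper T e) g)) =
      (\<Prod>g\<in>boundary T S - {f}. psi (lower T g))"
    by (intro prod.cong) auto
  then show ?thesis
    unfolding psi_forest_diff[OF rooted_tree_upper[OF T] S'] b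
    by (subst prod.remove[OF finite_boundary[OF T] f]) (simp add: nested_cuts(3)[OF T fT e] mult.commute)
qed

text \<open>The product rule differentiates one component \<open>lower T f\<close> at a time. In
  \<open>pderiv_psi\<close> for this component, the constant term corresponds to cutting \<open>f\<close> itself, and
  the sum to cutting an edge inside the component; together these are all edges outside
  \<open>S\<close>, each once.\<close>

lemma pderiv_psi_forest:
  assumes T: "rooted_tree T" and S: "rooted_subtree S T"
  shows "pderiv (psi_forest (forest_diff T S)) =
    (\<Sum>e\<in>edges T - edges S. smult (phi (lower T e)) (psi_forest (forest_diff (upper T e) S)))"
proof -
  let ?B = "boundary T S" and ?F = "\<lambda>e. smult (phi (lower T e)) (psi_forest (forest_diff (upper T e) S))"
  have fin: "finite (edges (lower T f))" for f
    using finite_subset[OF _ rooted_treeD(5)[OF T]] by (auto simp: lower_def)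
  have "pderiv (psi_forest (forest_diff T S)) =
      (\<Sum>f\<in>?B. (\<Prod>g\<in>?B - {f}. psi (lower T g)) * pderiv (psi (lower T f)))"
    by (simp add: psi_forest_diff[OF T S] pderiv_prod)
  also have "\<dots> = (\<Sum>f\<in>?B. \<Sum>e\<in>insert f (edges (lower T f)). ?F e)"
  proof (rule sum.cong[OF refl])
    fix f assume f: "f \<in> ?B"
    then have fT: "f \<in> edges T" by (simp add: boundary_def)
    let ?P = "\<Prod>g\<in>?B - {f}. psi (lower T g)"
    have "?F e = ?P * smult (phi (lower (lower T f) e)) (psi (upper (lower T f) e))"
      if "e \<in> edges (lower T f)" for e
      by (simp add: psi_forest_cut_inner[OF T S f that] nested_cuts(2)[OF T fT that])
    moreover have "?F f = ?P * [:phi (lower T f):]"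
      by (simp add: psi_forest_cut_boundary[OF T S f])
    moreover have "f \<notin> edges (lower T f)" using boundary_meets_lower[OF T S f f] .
    ultimately show "?P * pderiv (psi (lower T f)) = (\<Sum>e\<in>insert f (edges (lower T f)). ?F e)"
      using fin[of f]
      by (simp add: pderiv_psi[OF rooted_tree_lower[OF T fT]] distrib_left sum_distrib_left)
  qed
  also have "\<dots> = sum ?F (\<Union>f\<in>?B. insert f (edges (lower T f)))"
  proof (rule sum.UNION_disjoint[symmetric])
    show "\<forall>f\<in>?B. \<forall>g\<in>?B. f \<noteq> g \<longrightarrow> insert f (edges (lower T f)) \<inter> insert g (edges (lower T g)) = {}"
      using boundary_meets_lower[OF T S] boundary_edges_disjoint[OF T S] by auto
  qed (use finite_boundary[OF T] fin in auto)
  finally show ?thesis by (simp add: edges_outside_subtree[OF T S])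
qed

lemma rooted_subtree_refl: "rooted_tree T \<Longrightarrow> rooted_subtree T T"
  by (auto simp: rooted_tree_def rooted_subtree_def)

lemma psi_forest_diff_self: "psi_forest (forest_diff T T) = 1"
  by (simp add: forest_diff_def psi_forest_def Let_def)

text \<open>A proper subtree has a boundary edge, so the product has a factor with vanishing constant
  term.\<close>

lemma poly_psi_forest_0:
  assumes T: "rooted_tree T" and S: "S \<in> proper_subtrees T"
  shows "poly (psi_forest (forest_diff T S)) 0 = 0"
proof -
  have S': "rooted_subtree S T" and ne: "S \<noteq> T" using S by (auto simp: proper_subtrees_def)
  have "edges S \<noteq> edges T"
  proof
    assume E: "edges S = edges T"
    have "verts S \<subseteq> verts T" using S' by (simp add: rooted_subtree_def)
    moreover have "verts T \<subseteq> verts S"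
      using boundary_cover[OF T S'] edges_outside_subtree[OF T S'] E by auto
    ultimately show False using S' ne E by (auto simp: rooted_subtree_def)
  qed
  then have "edges T - edges S \<noteq> {}" using S' by (auto simp: rooted_subtree_def)
  then obtain f where f: "f \<in> boundary T S" using edges_outside_subtree[OF T S'] by auto
  then have "poly (psi (lower T f)) 0 = 0"
    by (intro poly_psi_0 rooted_tree_lower T) (simp add: boundary_def)
  then show ?thesis
    using f finite_boundary[OF T] by (auto simp: psi_forest_diff[OF T S'] poly_prod)
qed

section \<open>Polynomials in one and two variables\<close>

lemma poly_eq_pderivI:
  fixes p q :: "rat poly"
  assumes "pderiv p = pderiv q" "poly p 0 = poly q 0"
  shows "p = q"
proof -
  have "pderiv (p - q) = 0" using assms(1) by (simp add: pderiv_diff)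
  then obtain c where c: "p - q = [:c:]" using pderiv_iszero by blast
  moreover have "poly (p - q) 0 = 0" using assms(2) by simp
  ultimately show ?thesis by simp
qed

lemma smult_sum_right: "smult c (sum f A) = (\<Sum>x\<in>A. smult c (f x))"
  by (induction A rule: infinite_finite_induct) (simp_all add: smult_add_right)

lemma pderiv_sum: "pderiv (sum f A) = (\<Sum>x\<in>A. pderiv (f x))"
  by (induction A rule: infinite_finite_induct) (simp_all add: pderiv_add)

text \<open>Setting \<open>s\<close> to the rational \<open>b\<close> in a polynomial over $\mathbb{Q}[t]$ is evaluation at the
  constant polynomial \<open>[:b:]\<close>; under it, \<open>t + s\<close> becomes the translation \<open>[:b, 1:]\<close>.\<close>

lemma poly_subst: "poly (subst p x) [:b:] = p \<circ>\<^sub>p poly x [:b:]"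
  unfolding subst_def
  by (induction p) (simp_all add: map_poly_pCons pcompose_pCons)

text \<open>The constants are infinitely many elements of the integral domain $\mathbb{Q}[t]$, so
  a polynomial over it that vanishes at all of them is zero. This permits treating \<open>s\<close> as a
  rational number.\<close>

lemma bivariate_eqI:
  fixes P Q :: "rat poly poly"
  assumes "\<And>b. poly P [:b:] = poly Q [:b:]"
  shows "P = Q"
proof (rule ccontr)
  assume "P \<noteq> Q"
  then have "finite {x. poly (P - Q) x = 0}" by (intro poly_roots_finite) simp
  then have "finite (range (\<lambda>b::rat. [:b:]))"
    by (rule finite_subset[rotated]) (use assms in auto)
  then have "finite (UNIV :: rat set)" by (rule finite_imageD) (simp add: inj_on_def)
  then show False using infinite_UNIV_char_0 by blast
qed

section \<open>The addition formula\<close>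

lemma finite_subtrees:
  assumes T: "rooted_tree T" shows "finite {S. rooted_subtree S T}"
proof (rule finite_subset)
  show "{S. rooted_subtree S T} \<subseteq>
      (\<lambda>(V, E). \<lparr>verts = V, edges = E, root = root T\<rparr>) ` (Pow (verts T) \<times> Pow (edges T))"
  proof
    fix S assume "S \<in> {S. rooted_subtree S T}"
    then show "S \<in> (\<lambda>(V, E). \<lparr>verts = V, edges = E, root = root T\<rparr>) ` (Pow (verts T) \<times> Pow (edges T))"
      by (intro image_eqI[of _ _ "(verts S, edges S)"]) (auto simp: rooted_subtree_def)
  qed
  show "finite ((\<lambda>(V, E). \<lparr>verts = V, edges = E, root = root T\<rparr>) ` (Pow (verts T) \<times> Pow (edges T)))"
    using rooted_treeD(1,5)[OF T] by simp
qed

text \<open>The addition formula for rational \<open>s = b\<close>, by induction on the size of the tree. The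
  subtree \<open>T\<close> itself belongs to the sum; it contributes the constant $\psi_T(b)$, because the
  empty forest has \<open>psi_forest {} = 1\<close>. Both sides agree at \<open>t = 0\<close>, so it is enough to compare
  derivatives, and there the induction hypothesis applies to every \<open>upper T e\<close>.\<close>

lemma psi_translate:
  fixes T :: "'a rgraph"
  assumes "rooted_tree T"
  shows "psi T \<circ>\<^sub>p [:b, 1:] =
    psi T + (\<Sum>S | rooted_subtree S T. smult (poly (psi S) b) (psi_forest (forest_diff T S)))"
  using assms
proof (induction "card (verts T)" arbitrary: T rule: less_induct)
  case less
  note T = less.prems
  let ?Sub = "{S. rooted_subtree S T}"
  let ?W = "\<lambda>T S. smult (poly (psi S) b) (psi_forest (forest_diff T S))"
  let ?F = "\<lambda>e S. smult (phi (lower T e)) (?W (upper T e) S)"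
  note finE = rooted_treeD(5)[OF T] and finS = finite_subtrees[OF T]
  show ?case
  proof (rule poly_eq_pderivI)
    have "pderiv (psi T \<circ>\<^sub>p [:b, 1:]) = pderiv (psi T) \<circ>\<^sub>p [:b, 1:]"
      by (simp add: pderiv_pcompose pderiv_pCons)
    also have "\<dots> = [:phi T:] + (\<Sum>e\<in>edges T. smult (phi (lower T e)) (psi (upper T e) \<circ>\<^sub>p [:b, 1:]))"
      by (simp add: pderiv_psi[OF T] pcompose_add pcompose_sum pcompose_smult)
    also have "\<dots> = [:phi T:] + (\<Sum>e\<in>edges T. smult (phi (lower T e)) (psi (upper T e))
        + (\<Sum>S | S \<in> ?Sub \<and> e \<notin> edges S. ?F e S))"
    proof -
      have "smult (phi (lower T e)) (psi (upper T e) \<circ>\<^sub>p [:b, 1:]) =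
        smult (phi (lower T e)) (psi (upper T e)) + (\<Sum>S | S \<in> ?Sub \<and> e \<notin> edges S. ?F e S)"
        if e: "e \<in> edges T" for e
        by (simp add: less.hyps[OF card_upper_less[OF T e] rooted_tree_upper[OF T]]
            subtree_upper_iff[OF T e] smult_add_right smult_sum_right)
      then show ?thesis by simp
    qed
    also have "\<dots> = pderiv (psi T) + (\<Sum>e\<in>edges T. \<Sum>S | S \<in> ?Sub \<and> e \<notin> edges S. ?F e S)"
      by (simp add: pderiv_psi[OF T] sum.distrib)
    \<comment> \<open>An edge and a subtree above it become a subtree and an edge outside it.\<close>
    also have "(\<Sum>e\<in>edges T. \<Sum>S | S \<in> ?Sub \<and> e \<notin> edges S. ?F e S) =
        (\<Sum>S\<in>?Sub. \<Sum>e | e \<in> edges T \<and> e \<notin> edges S. ?F e S)"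
      by (rule sum.swap_restrict[OF finE finS])
    also have "\<dots> = (\<Sum>S\<in>?Sub. pderiv (?W T S))"
      by (intro sum.cong)
         (auto simp: pderiv_smult pderiv_psi_forest[OF T] smult_sum_right set_diff_eq mult.commute)
    finally show "pderiv (psi T \<circ>\<^sub>p [:b, 1:]) = pderiv (psi T + sum (?W T) ?Sub)"
      by (simp add: pderiv_add pderiv_sum)
  next
    have "?Sub = insert T (proper_subtrees T)" "T \<notin> proper_subtrees T"
      using rooted_subtree_refl[OF T] by (auto simp: proper_subtrees_def)
    moreover have "(\<Sum>S\<in>proper_subtrees T. poly (?W T S) 0) = 0"
      by (intro sum.neutral) (simp add: poly_psi_forest_0[OF T])
    ultimately show "poly (psi T \<circ>\<^sub>p [:b, 1:]) 0 = poly (psi T + sum (?W T) ?Sub) 0"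
      using finS by (simp add: poly_pcompose poly_sum poly_psi_0[OF T] psi_forest_diff_self)
  qed
qed

theorem theorem4p1:
  fixes T :: "'a rgraph"
  assumes "rooted_tree T"
  shows "subst (psi T) (var_t + var_s) =
    subst (psi T) var_t + subst (psi T) var_s +
    (\<Sum>T' \<in> proper_subtrees T. subst (psi_forest (forest_diff T T')) var_t * subst (psi T') var_s)"
proof (rule bivariate_eqI)
  fix b :: rat
  have "{S. rooted_subtree S T} = insert T (proper_subtrees T)" "T \<notin> proper_subtrees T"
    using rooted_subtree_refl[OF assms] by (auto simp: proper_subtrees_def)
  then have "psi T \<circ>\<^sub>p [:b, 1:] = psi T + [:poly (psi T) b:] +
      (\<Sum>S\<in>proper_subtrees T. smult (poly (psi S) b) (psi_forest (forest_diff T S)))"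
    using psi_translate[OF assms, of b] finite_subtrees[OF assms]
    by (simp add: psi_forest_diff_self)
  moreover have "p \<circ>\<^sub>p [:0, 1:] = p" "p \<circ>\<^sub>p [:b:] = [:poly p b:]" for p :: "rat poly"
    by (simp add: pcompose_idR) (induction p; simp add: pcompose_pCons)
  ultimately show "poly (subst (psi T) (var_t + var_s)) [:b:] =
    poly (subst (psi T) var_t + subst (psi T) var_s +
    (\<Sum>T' \<in> proper_subtrees T. subst (psi_forest (forest_diff T T')) var_t * subst (psi T') var_s)) [:b:]"
    by (simp add: poly_subst var_t_def var_s_def poly_sum)
qed

end
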